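(* Let $G$ be a finite abelian group. Then $\varphi(G)\leq|\mathrm{Aut}(G)|$, and equality holds if and only if $G$ is cyclic.
   Context: For a finite group $G$, $\exp(G)$ denotes its exponent (the least common multiple of the orders of its elements), $o(a)$ the order of $a\in G$, and $\varphi(G)=|\{a\in G \mid o(a)=\exp(G)\}|$. $\mathrm{Aut}(G)$ is the automorphism group of $G$. *)

theory Defs
  imports "HOL-Algebra.Algebra" "HOL-Algebra.Bij" "HOL-Algebra.Elementary_Groups"
begin

definition group_exp :: "('a, 'b) monoid_scheme \<Rightarrow> nat"
  where "group_exp G = Lcm (group.ord G ` carrier G)"

definition num_exp_order :: "('a, 'b) monoid_scheme \<Rightarrow> nat"
  where "num_exp_order G = card {a \<in> carrier G. group.ord G a = group_exp G}"

end

theory Submission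
  imports Defs "HOL-Number_Theory.Cong"
begin

text \<open>
  Let n = exp G. Homomorphisms into Z/n extend from subgroups of G, so for every a of order n there
  is a homomorphism f to Z/n with f a = 1. For a, b of order n, combining two of these gives one
  that takes unit values at both a and b; rescaled to f a = 1, it yields the automorphism
  x \<mapsto> x (b / a)^(f x), which maps a to b. So Aut G acts transitively on the elements of order n,
  which proves the inequality. If a does not generate G, then some nonzero homomorphism g vanishes
  at a, and x \<mapsto> x a^(g x) is a nontrivial automorphism fixing a, which makes the inequality strict.
  If G is cyclic, an automorphism is determined by the image of a generator.
\<close>

text \<open>Homomorphisms into Z/n are represented by integer-valued functions, additive modulo n.\<close>

definition mod_additive :: "('a, 'b) monoid_scheme \<Rightarrow> nat \<Rightarrow> 'a set \<Rightarrow> ('a \<Rightarrow> int) \<Rightarrow> bool"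
  where "mod_additive G n H f \<longleftrightarrow>
    (\<forall>x\<in>H. \<forall>y\<in>H. [f (x \<otimes>\<^bsub>G\<^esub> y) = f x + f y] (mod int n))"

lemma mod_additiveD:
  "mod_additive G n H f \<Longrightarrow> x \<in> H \<Longrightarrow> y \<in> H \<Longrightarrow> [f (x \<otimes>\<^bsub>G\<^esub> y) = f x + f y] (mod int n)"
  by (simp add: mod_additive_def)

lemma mod_additive_lincomb:
  assumes "mod_additive G n H f" "mod_additive G n H g"
  shows "mod_additive G n H (\<lambda>x. i * f x + j * g x)"
  unfolding mod_additive_def
proof (intro ballI)
  fix x y assume "x \<in> H" "y \<in> H"
  then have "[i * f (x \<otimes>\<^bsub>G\<^esub> y) + j * g (x \<otimes>\<^bsub>G\<^esub> y)
      = i * (f x + f y) + j * (g x + g y)] (mod int n)"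
    using assms by (intro cong_add cong_scalar_left mod_additiveD)
  then show "[i * f (x \<otimes>\<^bsub>G\<^esub> y) + j * g (x \<otimes>\<^bsub>G\<^esub> y)
      = i * f x + j * g x + (i * f y + j * g y)] (mod int n)"
    by (simp add: algebra_simps)
qed

section \<open>An arithmetic lemma on simultaneous coprimality\<close>

text \<open>If f a = g b = 1, s = g a and k = f b, then the two terms are the values of i f + j g at
  a and at b, so this finds a combination with unit values at both. Modulo a prime p each term is a
  nonzero linear form in (i, j), and two lines never cover the plane over Z/p; the primes dividing n
  are then handled all at once by products.\<close>

lemma coprime_lincomb:
  fixes n s k :: int
  assumes "n \<noteq> 0"
  obtains i j where "coprime (i + j * s) n" "coprime (i * k + j) n"
proof -
  define P where "P = {p. Factorial_Ring.prime p \<and> p dvd n}"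
  have "finite P" using finite_prime_divisors[OF assms] by (simp add: P_def)
  \<comment> \<open>By the choice of i and j, for every p in P exactly one summand of each combination is divisible by p.\<close>
  define i where "i = \<Prod>{p \<in> P. p dvd k \<and> \<not> p dvd s}"
  define j where "j = \<Prod>{p \<in> P. \<not> p dvd k}"
  have dvd_prod: "p dvd \<Prod>{p \<in> P. Q p} \<longleftrightarrow> Q p" if "p \<in> P" for p Q
  proof
    have p: "Factorial_Ring.prime p" and fin: "finite {p \<in> P. Q p}"
      using that \<open>finite P\<close> by (simp add: P_def, simp)
    assume "p dvd \<Prod>{p \<in> P. Q p}"
    then obtain q where "q \<in> P" "Q q" "p dvd q"
      using prime_dvd_prod_iff[OF fin p, of "\<lambda>q. q"] by auto
    then show "Q p" using primes_dvd_imp_eq[OF p, of q] by (simp add: P_def)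
  next
    assume "Q p"
    then show "p dvd \<Prod>{p \<in> P. Q p}" using that \<open>finite P\<close> by (intro dvd_prodI) auto
  qed
  have ij: "p dvd i \<longleftrightarrow> p dvd k \<and> \<not> p dvd s" "p dvd j \<longleftrightarrow> \<not> p dvd k" if "p \<in> P" for p
    unfolding i_def j_def using that by (simp_all add: dvd_prod)
  have "coprime x n" if "\<And>p. p \<in> P \<Longrightarrow> \<not> p dvd x" for x
  proof (rule ccontr)
    assume "\<not> coprime x n"
    then obtain p where "Factorial_Ring.prime p" "p dvd gcd x n"
      using prime_divisorE[of "gcd x n"] assms by (auto simp: is_unit_gcd)
    then show False using that[of p] by (simp add: P_def)
  qed
  moreover have "\<not> p dvd i + j * s \<and> \<not> p dvd i * k + j" if "p \<in> P" for p
  proof -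
    have p: "Factorial_Ring.prime p" using that by (simp add: P_def)
    consider "\<not> p dvd k" | "p dvd k" "\<not> p dvd s" | "p dvd k" "p dvd s" by blast
    then show ?thesis
    proof cases
      case 1
      then have "\<not> p dvd i" "p dvd j * s" "\<not> p dvd i * k" "p dvd j"
        using ij[OF that] p by (auto simp: prime_dvd_mult_iff)
      then show ?thesis using dvd_add_left_iff by blast
    next
      case 2
      then have "p dvd i" "\<not> p dvd j * s" "p dvd i * k" "\<not> p dvd j"
        using ij[OF that] p by (auto simp: prime_dvd_mult_iff)
      then show ?thesis using dvd_add_right_iff by blast
    next
      case 3
      then have "\<not> p dvd i" "p dvd j * s" "p dvd i * k" "\<not> p dvd j"
        using ij[OF that] p by (auto simp: prime_dvd_mult_iff)
      then show ?thesis using dvd_add_left_iff dvd_add_right_iff by blast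
    qed
  qed
  ultimately show ?thesis using that by blast
qed

section \<open>Homomorphisms from subgroups to Z/n, and powers of elements\<close>

context group
begin

lemma mod_additive_one:
  assumes "subgroup H G" "mod_additive G n H f"
  shows "[f \<one> = 0] (mod int n)"
  using mod_additiveD[OF assms(2), of \<one> \<one>] assms(1)
  by (simp add: subgroup.one_closed cong_iff_dvd_diff)

lemma mod_additive_nat_pow:
  assumes "subgroup H G" "mod_additive G n H f" "x \<in> H"
  shows "[f (x [^] (k::nat)) = int k * f x] (mod int n)"
proof (induction k)
  case 0
  then show ?case using mod_additive_one[OF assms(1,2)] by simp
next
  case (Suc k)
  have "x [^] k \<in> H"
    using subgroup_int_pow_closed[OF assms(1,3), of "int k"] by (simp add: int_pow_int)
  then have "[f (x [^] k \<otimes> x) = f (x [^] k) + f x] (mod int n)"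
    using assms by (intro mod_additiveD)
  also have "[f (x [^] k) + f x = int k * f x + f x] (mod int n)"
    using Suc by (intro cong_add) auto
  finally show ?case by (simp add: algebra_simps)
qed

lemma mod_additive_inv:
  assumes "subgroup H G" "mod_additive G n H f" "x \<in> H"
  shows "[f (inv x) = - f x] (mod int n)"
proof -
  have x: "x \<in> carrier G" "inv x \<in> H"
    using assms subgroup.mem_carrier subgroup.m_inv_closed by metis+
  have "[f (x \<otimes> inv x) = f x + f (inv x)] (mod int n)"
    using assms x by (intro mod_additiveD)
  moreover have "[f \<one> = 0] (mod int n)" using mod_additive_one assms by blast
  ultimately have "[f x + f (inv x) = 0] (mod int n)"
    using x by (metis r_inv cong_sym cong_trans)
  then show ?thesis by (simp add: cong_iff_dvd_diff add.commute)
qed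

lemma mod_additive_int_pow:
  assumes "subgroup H G" "mod_additive G n H f" "x \<in> H"
  shows "[f (x [^] (k::int)) = k * f x] (mod int n)"
proof (cases k rule: int_cases2)
  case (nonneg m)
  then show ?thesis using mod_additive_nat_pow[OF assms, of m] by (simp add: int_pow_int)
next
  case (nonpos m)
  have x: "x \<in> carrier G" using assms subgroup.mem_carrier by metis
  have "x [^] m \<in> H"
    using subgroup_int_pow_closed[OF assms(1,3), of "int m"] by (simp add: int_pow_int)
  then have "[f (inv (x [^] m)) = - f (x [^] m)] (mod int n)"
    using assms by (intro mod_additive_inv)
  also have "[- f (x [^] m) = - (int m * f x)] (mod int n)"
    using mod_additive_nat_pow[OF assms, of m] by (simp add: cong_minus_minus_iff)
  finally show ?thesis using nonpos x by (simp add: int_pow_neg_int)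
qed

text \<open>This lets \<open>f x\<close> serve as an exponent when f is controlled only modulo
  n.\<close>

lemma int_pow_cong:
  assumes "x \<in> carrier G" "x [^] n = \<one>" "[i = j] (mod int n)"
  shows "x [^] i = x [^] j"
proof -
  have "int (ord x) dvd int n" using assms pow_eq_id by simp
  then have "int (ord x) dvd i - j" using assms(3) by (meson cong_iff_dvd_diff dvd_trans)
  then show ?thesis using assms(1) int_pow_eq by metis
qed

text \<open>The exponents i with g^i in H form an ideal of the integers, nonzero because it contains
  n. Its positive generator m is the order of g modulo H.\<close>

lemma subgroup_pow_mem_dvd:
  assumes "subgroup H G" "g \<in> carrier G" "g [^] n \<in> H" "0 < (n::nat)"
  obtains m :: nat where "0 < m" "\<And>i::int. g [^] i \<in> H \<longleftrightarrow> int m dvd i"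
proof -
  define m :: nat where "m = (LEAST m. 0 < m \<and> g [^] m \<in> H)"
  have m: "0 < m" "g [^] m \<in> H"
    using LeastI[of "\<lambda>m. 0 < m \<and> g [^] m \<in> H" n] assms unfolding m_def by auto
  have mem: "g [^] (int m * q) \<in> H" for q
  proof -
    have "(g [^] int m) [^] q \<in> H"
      using m by (intro subgroup_int_pow_closed[OF assms(1), of "g [^] int m"]) (simp add: int_pow_int)
    then show ?thesis using assms(2) by (simp add: int_pow_pow)
  qed
  have "int m dvd i" if "g [^] i \<in> H" for i
  proof -
    define r where "r = nat (i mod int m)"
    have r: "int r = i mod int m" using m by (simp add: r_def)
    have "g [^] (i - int m * (i div int m)) \<in> H"
      using that mem[of "i div int m"] assms(1,2)
      by (simp add: int_pow_diff subgroup.m_closed subgroup.m_inv_closed)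
    then have "g [^] r \<in> H"
      by (simp add: minus_mult_div_eq_mod flip: r int_pow_int)
    moreover have "r < m" using r m by (metis of_nat_0_less_iff of_nat_less_iff pos_mod_bound)
    ultimately have "r = 0" using not_less_Least[of r "\<lambda>m. 0 < m \<and> g [^] m \<in> H"]
      unfolding m_def by auto
    then show ?thesis using r by (simp add: mod_eq_0_iff_dvd)
  qed
  moreover have "g [^] i \<in> H" if "int m dvd i" for i using that mem by (elim dvdE) simp
  ultimately show ?thesis using that m(1) by blast
qed

end

section \<open>Extending homomorphisms into Z/n from subgroups\<close>

context comm_group
begin

text \<open>This is the subgroup generated by H and g; closure under products rests on
  commutativity.\<close>

lemma subgroup_mult_int_pow:
  assumes "subgroup H G" "g \<in> carrier G"
  shows "subgroup {h \<otimes> g [^] (i::int) | h i. h \<in> H} G" (is "subgroup ?K G")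
proof
  have H: "h \<in> carrier G" if "h \<in> H" for h using that assms(1) subgroup.mem_carrier by metis
  show "?K \<subseteq> carrier G" using H assms(2) by auto
  show "\<one> \<in> ?K"
    using subgroup.one_closed[OF assms(1)] by (intro CollectI exI[of _ \<one>] exI[of _ "0::int"]) simp
  fix x assume "x \<in> ?K"
  then obtain h i where x: "x = h \<otimes> g [^] (i::int)" "h \<in> H" by auto
  have "inv x = inv h \<otimes> g [^] (-i)"
    using x H assms(2) by (simp add: inv_mult int_pow_neg)
  then show "inv x \<in> ?K" using subgroup.m_inv_closed[OF assms(1) x(2)] by blast
  fix y assume "y \<in> ?K"
  then obtain h' i' where y: "y = h' \<otimes> g [^] (i'::int)" "h' \<in> H" by auto
  have "x \<otimes> y = (h \<otimes> h') \<otimes> g [^] (i + i')"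
    using x y H assms(2) by (simp add: int_pow_mult m_ac)
  then show "x \<otimes> y \<in> ?K" using subgroup.m_closed[OF assms(1) x(2) y(2)] by blast
qed

text \<open>A value s at g has to satisfy m s = f(g^m), where m is the order of g modulo H. Since
  g^n = 1 lies in H, n = m d for some d, and d f(g^m) = f(g^n) = 0 modulo m d; hence m divides
  f(g^m) and s exists. The extension is h g^i \<mapsto> f h + i s.\<close>

lemma mod_additive_extend_step:
  assumes H: "subgroup H G" and f: "mod_additive G n H f"
    and g: "g \<in> carrier G" "g [^] n = \<one>" and n: "0 < n"
  obtains f' where "mod_additive G n {h \<otimes> g [^] (i::int) | h i. h \<in> H} f'"
    "\<forall>h\<in>H. [f' h = f h] (mod int n)"
proof -
  let ?K = "{h \<otimes> g [^] (i::int) | h i. h \<in> H}"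
  have Hc: "h \<in> carrier G" if "h \<in> H" for h using that H subgroup.mem_carrier by metis
  obtain m :: nat where m: "0 < m" "\<And>i::int. g [^] i \<in> H \<longleftrightarrow> int m dvd i"
    using subgroup_pow_mem_dvd[OF H g(1) _ n] g(2) subgroup.one_closed[OF H] by metis
  have gm: "g [^] int m \<in> H" using m by simp
  have "int m dvd int n" using m(2)[of "int n"] g subgroup.one_closed[OF H] by (simp add: int_pow_int)
  then obtain d where d: "int n = int m * d" by (elim dvdE)
  have "[f ((g [^] int m) [^] d) = d * f (g [^] int m)] (mod int n)"
    using mod_additive_int_pow[OF H f gm] .
  moreover have "(g [^] int m) [^] d = \<one>"
    using g d by (simp add: int_pow_pow) (metis int_pow_int)
  ultimately have "[d * f (g [^] int m) = 0] (mod int n)"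
    using mod_additive_one[OF H f] by (metis cong_sym cong_trans)
  then have "int m * d dvd d * f (g [^] int m)" using d by (simp add: cong_0_iff)
  moreover have "d \<noteq> 0" using d n by auto
  ultimately have "int m dvd f (g [^] int m)" by (simp add: mult.commute)
  then obtain s where s: "f (g [^] int m) = int m * s" by (elim dvdE)
  \<comment> \<open>Two ways of writing an element as h g^i differ by a power of g that lies in H,
    hence by a power of g^m, where f is known by the choice of s.\<close>
  have wd: "[f h + i * s = f h' + i' * s] (mod int n)"
    if "h \<in> H" "h' \<in> H" "h \<otimes> g [^] i = h' \<otimes> g [^] i'" for h h' and i i' :: int
  proof -
    have e: "h = h' \<otimes> g [^] (i' - i)"
    proof -
      have "h = (h \<otimes> g [^] i) \<otimes> inv (g [^] i)" using Hc[OF that(1)] g by (simp add: m_assoc)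
      also have "\<dots> = (h' \<otimes> g [^] i') \<otimes> inv (g [^] i)" by (simp only: that(3))
      also have "\<dots> = h' \<otimes> g [^] (i' - i)" using that Hc g by (simp add: m_assoc int_pow_diff)
      finally show ?thesis .
    qed
    then have "g [^] (i' - i) = inv h' \<otimes> h" using that Hc g by (simp add: inv_solve_left)
    then have "g [^] (i' - i) \<in> H"
      using that H by (simp add: subgroup.m_closed subgroup.m_inv_closed)
    moreover from this obtain q where q: "i' - i = int m * q" using m(2) by (auto simp: dvd_def)
    ultimately have "[f h = f h' + f (g [^] (i' - i))] (mod int n)"
      using mod_additiveD[OF f that(2)] e by metis
    also have "g [^] (i' - i) = (g [^] int m) [^] q" using q g by (simp add: int_pow_pow)
    also have "[f h' + f ((g [^] int m) [^] q) = f h' + q * (int m * s)] (mod int n)"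
      using mod_additive_int_pow[OF H f gm, of q] s by (intro cong_add) auto
    also have "q * (int m * s) = (i' - i) * s" using q by simp
    finally have "[f h + i * s = f h' + (i' - i) * s + i * s] (mod int n)"
      by (intro cong_add) auto
    then show ?thesis by (simp add: algebra_simps)
  qed
  \<comment> \<open>An arbitrary decomposition of x is selected; by \<open>wd\<close> the choice
    does not affect f' modulo n.\<close>
  define rep where "rep x = (SOME p. fst p \<in> H \<and> x = fst p \<otimes> g [^] (snd p :: int))" for x
  define f' where "f' x = f (fst (rep x)) + snd (rep x) * s" for x
  have f': "[f' (h \<otimes> g [^] i) = f h + i * s] (mod int n)" if "h \<in> H" for h and i :: int
  proof -
    let ?x = "h \<otimes> g [^] i"
    have "fst (rep ?x) \<in> H \<and> ?x = fst (rep ?x) \<otimes> g [^] snd (rep ?x)"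
      unfolding rep_def by (rule someI[of _ "(h, i)"]) (use that in simp)
    then show ?thesis unfolding f'_def using wd that by metis
  qed
  have "mod_additive G n ?K f'"
    unfolding mod_additive_def
  proof (intro ballI)
    fix x y assume "x \<in> ?K" "y \<in> ?K"
    then obtain h i h' i' where x: "x = h \<otimes> g [^] (i::int)" "h \<in> H"
      and y: "y = h' \<otimes> g [^] (i'::int)" "h' \<in> H" by auto
    have e: "x \<otimes> y = (h \<otimes> h') \<otimes> g [^] (i + i')"
      using x y Hc g by (simp add: int_pow_mult m_ac)
    have "[f' (x \<otimes> y) = f (h \<otimes> h') + (i + i') * s] (mod int n)"
      unfolding e using x y H by (intro f') (simp add: subgroup.m_closed)
    also have "[f (h \<otimes> h') + (i + i') * s = (f h + f h') + (i + i') * s] (mod int n)"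
      using mod_additiveD[OF f x(2) y(2)] by (intro cong_add) auto
    also have "(f h + f h') + (i + i') * s = (f h + i * s) + (f h' + i' * s)"
      by (simp add: algebra_simps)
    also have "[\<dots> = f' x + f' y] (mod int n)"
      using f' x y by (intro cong_add) (auto intro: cong_sym)
    finally show "[f' (x \<otimes> y) = f' x + f' y] (mod int n)" .
  qed
  moreover have "[f' h = f h] (mod int n)" if "h \<in> H" for h
    using f'[OF that, of 0] that Hc by simp
  ultimately show ?thesis using that by blast
qed

text \<open>Elements outside the subgroup are adjoined one at a time. Each one enlarges H strictly,
  so |G| - |H| decreases.\<close>

lemma mod_additive_extend:
  assumes fin: "finite (carrier G)" and n: "0 < n" "\<And>x. x \<in> carrier G \<Longrightarrow> x [^] n = \<one>"
    and "subgroup H G" "mod_additive G n H f"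
  shows "\<exists>f'. mod_additive G n (carrier G) f' \<and> (\<forall>h\<in>H. [f' h = f h] (mod int n))"
  using assms(4,5)
proof (induction "card (carrier G) - card H" arbitrary: H f rule: less_induct)
  case less
  have Hc: "H \<subseteq> carrier G" using less.prems(1) by (rule subgroup.subset)
  show ?case
  proof (cases "H = carrier G")
    case True
    then show ?thesis using less.prems by auto
  next
    case False
    then obtain g where g: "g \<in> carrier G" "g \<notin> H" using Hc by auto
    let ?K = "{h \<otimes> g [^] (i::int) | h i. h \<in> H}"
    obtain f' where f': "mod_additive G n ?K f'" "\<forall>h\<in>H. [f' h = f h] (mod int n)"
      using mod_additive_extend_step[OF less.prems g(1) n(2)[OF g(1)] n(1)] .
    have K: "subgroup ?K G" using less.prems(1) g(1) by (rule subgroup_mult_int_pow)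
    have "h \<in> ?K" if "h \<in> H" for h
      using that Hc by (intro CollectI exI[of _ h] exI[of _ "0::int"]) auto
    moreover have "g \<in> ?K"
      using g subgroup.one_closed[OF less.prems(1)]
      by (intro CollectI exI[of _ \<one>] exI[of _ "1::int"]) simp
    ultimately have HK: "H \<subset> ?K" using g(2) by blast
    have Kc: "?K \<subseteq> carrier G" using K by (rule subgroup.subset)
    have "card H < card ?K"
      by (intro psubset_card_mono HK finite_subset[OF Kc fin])
    moreover have "card ?K \<le> card (carrier G)" using fin Kc by (rule card_mono)
    ultimately have "card (carrier G) - card ?K < card (carrier G) - card H" by linarith
    from less.hyps[OF this K f'(1)] obtain f'' where
      f'': "mod_additive G n (carrier G) f''" "\<forall>h\<in>?K. [f'' h = f' h] (mod int n)" by blast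
    then show ?thesis using f'(2) HK by (blast intro: cong_trans)
  qed
qed

text \<open>On the cyclic subgroup of g, the map g^i \<mapsto> i (n / ord g) embeds into Z/n, and it
  extends to G. The value at g is nonzero modulo n unless g = 1, and it is 1 when g has order
  n.\<close>

lemma mod_additive_separating:
  assumes fin: "finite (carrier G)" and n: "0 < n" "\<And>x. x \<in> carrier G \<Longrightarrow> x [^] n = \<one>"
    and g: "g \<in> carrier G"
  obtains f where "mod_additive G n (carrier G) f" "[f g = int (n div ord g)] (mod int n)"
proof -
  let ?H = "range (\<lambda>i::int. g [^] i)"
  \<comment> \<open>The chosen exponent is determined only modulo \<open>ord g\<close>; the factor
    \<open>n div ord g\<close> makes the value well defined modulo n.\<close>
  define f where "f x = (SOME i::int. x = g [^] i) * int (n div ord g)" for x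
  have "ord g dvd n" using n g pow_eq_id by blast
  then have nd: "int n = int (ord g) * int (n div ord g)" by (metis dvd_mult_div_cancel of_nat_mult)
  have f: "[f (g [^] i) = i * int (n div ord g)] (mod int n)" for i
  proof -
    have "g [^] i = g [^] (SOME j::int. g [^] i = g [^] j)" by (rule someI) (rule refl)
    then have "int (ord g) dvd (SOME j::int. g [^] i = g [^] j) - i"
      using g int_pow_eq by metis
    then show ?thesis unfolding f_def cong_iff_dvd_diff nd
      by (simp add: mult_dvd_mono flip: left_diff_distrib)
  qed
  have H: "subgroup ?H G"
  proof
    show "?H \<subseteq> carrier G" using g by auto
    show "\<one> \<in> ?H" by (rule range_eqI[of _ _ 0]) simp
    fix x assume "x \<in> ?H"
    then obtain i :: int where x: "x = g [^] i" by auto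
    then show "inv x \<in> ?H" using g by (intro range_eqI[of _ _ "-i"]) (simp add: int_pow_neg)
    fix y assume "y \<in> ?H"
    then obtain j :: int where "y = g [^] j" by auto
    with x show "x \<otimes> y \<in> ?H" using g by (intro range_eqI[of _ _ "i + j"]) (simp add: int_pow_mult)
  qed
  have "mod_additive G n ?H f"
    unfolding mod_additive_def
  proof (intro ballI)
    fix x y assume "x \<in> ?H" "y \<in> ?H"
    then obtain i j :: int where xy: "x = g [^] i" "y = g [^] j" by auto
    then have "x \<otimes> y = g [^] (i + j)" using g by (simp add: int_pow_mult)
    then have "[f (x \<otimes> y) = (i + j) * int (n div ord g)] (mod int n)" using f by simp
    also have "(i + j) * int (n div ord g) = i * int (n div ord g) + j * int (n div ord g)"
      by (simp add: algebra_simps)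
    also have "[\<dots> = f x + f y] (mod int n)" unfolding xy using f by (intro cong_add cong_sym[OF f])
    finally show "[f (x \<otimes> y) = f x + f y] (mod int n)" .
  qed
  from mod_additive_extend[OF fin n H this] obtain f' where
    f': "mod_additive G n (carrier G) f'" "\<forall>h\<in>?H. [f' h = f h] (mod int n)" by blast
  have "g \<in> ?H" using g by (intro range_eqI[of _ _ 1]) simp
  then have "[f' g = f g] (mod int n)" using f' by blast
  also have "[f g = int (n div ord g)] (mod int n)" using f[of 1] g by simp
  finally show ?thesis using that f'(1) by blast
qed


section \<open>Automorphisms of the form x \<mapsto> x c^(f x)\<close>

text \<open>Applying f to the image of x gives f x (1 + f c). If the image is 1, then f x = 0 modulo
  n because 1 + f c is a unit, so c^(f x) = 1 and x = 1. Injectivity suffices since G is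
  finite.\<close>

lemma transvection_in_auto:
  assumes fin: "finite (carrier G)" and n: "\<And>x. x \<in> carrier G \<Longrightarrow> x [^] n = \<one>"
    and f: "mod_additive G n (carrier G) f" and c: "c \<in> carrier G"
    and cop: "coprime (1 + f c) (int n)"
  shows "(\<lambda>x\<in>carrier G. x \<otimes> c [^] f x) \<in> auto G"
proof -
  \<comment> \<open>The lambda is restricted because members of \<open>auto G\<close> are
    extensional on the carrier.\<close>
  let ?T = "\<lambda>x\<in>carrier G. x \<otimes> c [^] f x"
  have hom: "?T \<in> hom G G"
  proof (rule homI)
    fix x y assume xy: "x \<in> carrier G" "y \<in> carrier G"
    have "c [^] f (x \<otimes> y) = c [^] (f x + f y)"
      using c n[OF c] mod_additiveD[OF f xy] by (rule int_pow_cong)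
    then show "?T (x \<otimes> y) = ?T x \<otimes> ?T y" using xy c by (simp add: int_pow_mult m_ac)
  qed (use c in simp)
  then interpret T: group_hom G G ?T by unfold_locales
  have "x = \<one>" if x: "x \<in> carrier G" "?T x = \<one>" for x
  proof -
    have "[f (x \<otimes> c [^] f x) = f x + f (c [^] f x)] (mod int n)"
      using f x c by (intro mod_additiveD) auto
    also have "[f x + f (c [^] f x) = f x + f x * f c] (mod int n)"
      using mod_additive_int_pow[OF subgroup_self f c] by (intro cong_add) auto
    finally have "[f \<one> = f x * (1 + f c)] (mod int n)" using x by (simp add: algebra_simps)
    then have "[f x * (1 + f c) = 0] (mod int n)"
      using mod_additive_one[OF subgroup_self f] by (metis cong_sym cong_trans)
    then have "int n dvd f x * (1 + f c)" by (simp add: cong_0_iff)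
    then have "int n dvd f x" using cop by (simp add: coprime_commute coprime_dvd_mult_left_iff)
    then have "c [^] f x = c [^] (0::int)"
      by (intro int_pow_cong[OF c n[OF c]]) (simp add: cong_0_iff)
    then show "x = \<one>" using x by simp
  qed
  then have "inj_on ?T (carrier G)" using T.inj_on_one_iff by blast
  moreover from this have "?T ` carrier G = carrier G"
    using fin c by (intro endo_inj_surj) auto
  ultimately show ?thesis using hom by (simp add: auto_def Bij_def bij_betw_def)
qed

text \<open>With c = b/a, a homomorphism taking the value 1 at a gives a map sending a to b. Its
  value at b is 1 plus its value at c, so bijectivity requires a unit at b as well.\<close>

lemma auto_transitive_on_max_order:
  assumes fin: "finite (carrier G)" and n: "\<And>x. x \<in> carrier G \<Longrightarrow> x [^] n = \<one>"
    and a: "a \<in> carrier G" "ord a = n" and b: "b \<in> carrier G" "ord b = n"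
  obtains T where "T \<in> auto G" "T a = b"
proof -
  have n0: "0 < n" using a ord_ge_1[OF fin a(1)] by simp
  obtain f where f: "mod_additive G n (carrier G) f" "[f a = 1] (mod int n)"
    using mod_additive_separating[OF fin n0 n a(1)] a(2) n0 by auto
  obtain g where g: "mod_additive G n (carrier G) g" "[g b = 1] (mod int n)"
    using mod_additive_separating[OF fin n0 n b(1)] b(2) n0 by auto
  obtain i j where ij: "coprime (i + j * g a) (int n)" "coprime (i * f b + j) (int n)"
    using coprime_lincomb[of "int n" "g a" "f b"] n0 by auto
  define F where "F x = i * f x + j * g x" for x
  have "[F a = i * 1 + j * g a] (mod int n)"
    unfolding F_def using f by (intro cong_add cong_scalar_left) auto
  then have "coprime (F a) (int n)" using ij by (metis mult_1_right cong_imp_coprime cong_sym)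
  \<comment> \<open>The inverse w of F a modulo n normalizes F to the value 1 at a and keeps F b a
    unit.\<close>
  then obtain w where w: "[F a * w = 1] (mod int n)" using cong_solve_coprime_int by blast
  have "[F b = i * f b + j * 1] (mod int n)"
    unfolding F_def using g by (intro cong_add cong_scalar_left) auto
  then have "coprime (F b) (int n)" using ij by (metis mult_1_right cong_imp_coprime cong_sym)
  moreover have "coprime w (int n)"
    using w cong_imp_coprime[OF cong_sym[OF w]] by simp
  ultimately have cop: "coprime (w * F b) (int n)" by simp
  have wF: "mod_additive G n (carrier G) (\<lambda>x. w * F x)"
    using mod_additive_lincomb[OF f(1) g(1), of "w * i" "w * j"]
    by (simp add: F_def algebra_simps)
  define c where "c = b \<otimes> inv a"
  have c: "c \<in> carrier G" "c \<otimes> a = b" using a b by (simp_all add: c_def m_assoc)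
  have "[w * F b = w * F c + w * F a] (mod int n)"
    using mod_additiveD[OF wF c(1) a(1)] c by simp
  also have "[w * F c + w * F a = w * F c + 1] (mod int n)"
    using w by (intro cong_add) (auto simp: mult.commute)
  finally have "coprime (1 + w * F c) (int n)"
    using cop by (metis add.commute cong_imp_coprime)
  from transvection_in_auto[OF fin n wF c(1) this]
  have "(\<lambda>x\<in>carrier G. x \<otimes> c [^] (w * F x)) \<in> auto G" .
  moreover have "c [^] (w * F a) = c [^] (1::int)"
    using w by (intro int_pow_cong[OF c(1) n[OF c(1)]]) (simp add: mult.commute)
  then have "(\<lambda>x\<in>carrier G. x \<otimes> c [^] (w * F x)) a = b"
    using a c by (simp add: m_comm)
  ultimately show ?thesis using that by blast
qed

text \<open>A homomorphism with f a = 1 splits off the cyclic subgroup of a, so its kernel contains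
  some y \<noteq> 1 when a does not generate G. Some F vanishes at a but not at y, and then x
  \<mapsto> x a^(F x) fixes a and moves y.\<close>

lemma auto_nontrivial_stabilizer:
  assumes fin: "finite (carrier G)" and n: "\<And>x. x \<in> carrier G \<Longrightarrow> x [^] n = \<one>"
    and a: "a \<in> carrier G" "ord a = n" and ne: "carrier G \<noteq> range (\<lambda>i::int. a [^] i)"
  obtains T y where "T \<in> auto G" "T a = a" "y \<in> carrier G" "T y \<noteq> y"
proof -
  have n0: "0 < n" using a ord_ge_1[OF fin a(1)] by simp
  obtain f where f: "mod_additive G n (carrier G) f" "[f a = 1] (mod int n)"
    using mod_additive_separating[OF fin n0 n a(1)] a(2) n0 by auto
  obtain g where g: "g \<in> carrier G" "g \<notin> range (\<lambda>i::int. a [^] i)"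
    using ne a by blast
  \<comment> \<open>Projection of g to the kernel of f along the powers of a; it is trivial only if
    g is a power of a.\<close>
  define y where "y = g \<otimes> a [^] (- f g)"
  have y: "y \<in> carrier G" using a g by (simp add: y_def)
  have "y \<noteq> \<one>"
  proof
    assume "y = \<one>"
    then have "g = a [^] f g" using a g by (simp add: y_def int_pow_neg) (metis inv_equality inv_inv int_pow_closed inv_closed)
    then show False using g(2) by blast
  qed
  have "[f y = f g + f (a [^] (- f g))] (mod int n)"
    unfolding y_def using f a g by (intro mod_additiveD) auto
  also have "[f g + f (a [^] (- f g)) = f g + (- f g) * f a] (mod int n)"
    using mod_additive_int_pow[OF subgroup_self f(1) a(1)] by (intro cong_add cong_refl)
  also have "[f g + (- f g) * f a = f g + (- f g) * 1] (mod int n)"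
    using f(2) by (intro cong_add cong_scalar_left) auto
  finally have fy: "[f y = 0] (mod int n)" by simp
  obtain h where h: "mod_additive G n (carrier G) h" "[h y = int (n div ord y)] (mod int n)"
    using mod_additive_separating[OF fin n0 n y] by auto
  \<comment> \<open>Subtracting h(a) f kills the value at a, where f is 1, and keeps the value of h
    at y, where f is 0. The factor 1 matches the form in
    \<open>mod_additive_lincomb\<close>.\<close>
  define F where "F x = 1 * h x + (- h a) * f x" for x
  have F: "mod_additive G n (carrier G) F"
    unfolding F_def using h(1) f(1) by (rule mod_additive_lincomb)
  have "[F a = 1 * h a + (- h a) * 1] (mod int n)"
    unfolding F_def using f by (intro cong_add cong_scalar_left) auto
  then have Fa: "[F a = 0] (mod int n)" by simp
  have "[F y = 1 * int (n div ord y) + (- h a) * 0] (mod int n)"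
    unfolding F_def using h fy by (intro cong_add cong_scalar_left) auto
  then have Fy: "[F y = int (n div ord y)] (mod int n)" by simp
  \<comment> \<open>As y is not the identity, n / ord y lies strictly between 0 and n.\<close>
  have "\<not> n dvd n div ord y"
  proof -
    have "ord y dvd n" using n[OF y] y pow_eq_id by simp
    moreover have "1 < ord y" using ord_ge_1[OF fin y] ord_eq_1[OF y] \<open>y \<noteq> \<one>\<close> by linarith
    ultimately have "n div ord y < n" "0 < n div ord y"
      using n0 by (auto simp: dvd_div_eq_0_iff)
    then show ?thesis by (auto dest: dvd_imp_le)
  qed
  then have nFy: "\<not> int n dvd F y" using Fy by (metis cong_dvd_iff int_dvd_int_iff cong_sym_eq cong_0_iff cong_trans)
  have "[1 = 1 + F a] (mod int n)" using cong_add[OF cong_refl[of 1] Fa] by (simp add: cong_sym_eq)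
  then have "coprime (1 + F a) (int n)" using cong_imp_coprime by (metis coprime_1_left)
  from transvection_in_auto[OF fin n F a(1) this]
  have "(\<lambda>x\<in>carrier G. x \<otimes> a [^] F x) \<in> auto G" .
  moreover have "a [^] F a = a [^] (0::int)" using a(1) n[OF a(1)] Fa by (rule int_pow_cong)
  then have "(\<lambda>x\<in>carrier G. x \<otimes> a [^] F x) a = a" using a by simp
  moreover have "a [^] F y \<noteq> \<one>" using nFy int_pow_eq_id[OF a(1)] a(2) by simp
  then have "(\<lambda>x\<in>carrier G. x \<otimes> a [^] F x) y \<noteq> y" using y a by simp
  ultimately show ?thesis using that y by blast
qed

end

section \<open>Finiteness of Aut G, the exponent, and cyclic groups\<close>

lemma (in group) finite_auto:
  assumes "finite (carrier G)"
  shows "finite (auto G)"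
proof (rule finite_subset)
  show "auto G \<subseteq> carrier G \<rightarrow>\<^sub>E carrier G" by (auto simp: auto_def Bij_def hom_def PiE_def)
  show "finite (carrier G \<rightarrow>\<^sub>E carrier G)" using assms by (intro finite_PiE) auto
qed

lemma (in group) pow_group_exp: "x \<in> carrier G \<Longrightarrow> x [^] group_exp G = \<one>"
  by (simp add: group_exp_def pow_eq_id)

lemma (in group) group_exp_cyclic:
  assumes "a \<in> carrier G" "carrier G = range (\<lambda>i::int. a [^] i)"
  shows "ord a = group_exp G"
proof (rule dvd_antisym)
  show "ord a dvd group_exp G" using assms(1) by (simp add: group_exp_def)
  have "ord x dvd ord a" if x: "x \<in> carrier G" for x
  proof -
    obtain i :: int where i: "x = a [^] i" using x assms(2) by auto
    have "x [^] int (ord a) = \<one>"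
      using assms(1) by (simp add: i int_pow_pow int_pow_eq_id)
    then show ?thesis using x by (simp add: int_pow_eq_id)
  qed
  then show "group_exp G dvd ord a" unfolding group_exp_def by (intro Lcm_least) auto
qed

lemma order_AutoGroup: "order (AutoGroup G) = card (auto G)"
  by (simp add: order_def AutoGroup_def)

text \<open>Evaluation at the generator a is injective on automorphisms. The image T a generates G
  again, since T is surjective, and a generator has order exp G.\<close>

lemma (in group) card_auto_cyclic_le:
  assumes fin: "finite (carrier G)" and a: "a \<in> carrier G" "carrier G = range (\<lambda>i::int. a [^] i)"
  shows "card (auto G) \<le> num_exp_order G"
  unfolding num_exp_order_def
proof (rule card_inj_on_le[of "\<lambda>T. T a"])
  have T: "T (a [^] i) = T a [^] i" if "T \<in> auto G" for T and i :: int
    using that hom_int_pow[OF _ a(1) is_group is_group] by (auto simp: auto_def)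
  show "inj_on (\<lambda>T. T a) (auto G)"
  proof (rule inj_onI)
    fix S T assume ST: "S \<in> auto G" "T \<in> auto G" "S a = T a"
    have "S x = T x" if x: "x \<in> carrier G" for x
    proof -
      obtain i :: int where "x = a [^] i" using x a(2) by blast
      then show ?thesis using T[OF ST(1), of i] T[OF ST(2), of i] ST(3) by simp
    qed
    moreover have "S \<in> extensional (carrier G)" "T \<in> extensional (carrier G)"
      using ST by (auto simp: auto_def Bij_def)
    ultimately show "S = T" by (intro extensionalityI)
  qed
  show "(\<lambda>T. T a) ` auto G \<subseteq> {x \<in> carrier G. ord x = group_exp G}"
  proof safe
    fix T assume TG: "T \<in> auto G"
    then show c: "T a \<in> carrier G" using a by (auto simp: auto_def hom_def)
    have "T ` carrier G = carrier G" using TG by (auto simp: auto_def Bij_def bij_betw_def)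
    then have "carrier G = range (\<lambda>i::int. T a [^] i)"
      unfolding a(2) by (simp add: image_image T[OF TG])
    with c show "ord (T a) = group_exp G" by (rule group_exp_cyclic)
  qed
qed (use fin in auto)

theorem theorem3p3:
  fixes G :: "('a, 'b) monoid_scheme"
  assumes "comm_group G" and "finite (carrier G)"
  shows "num_exp_order G \<le> order (AutoGroup G) \<and>
    (num_exp_order G = order (AutoGroup G) \<longleftrightarrow> cyclic_group G)"
proof -
  interpret comm_group G by fact
  note fin = assms(2)
  define A where "A = {x \<in> carrier G. ord x = group_exp G}"
  have A: "num_exp_order G = card A" by (simp add: A_def num_exp_order_def)
  have main: "card A \<le> card (auto G) \<and> (\<not> cyclic_group G \<longrightarrow> card A < card (auto G))"
  \<comment> \<open>If A is empty, the count is 0, and the identity makes \<open>auto G\<close>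
    nonempty, which gives both claims.\<close>
  proof (cases "A = {}")
    case True
    then show ?thesis using id_in_auto finite_auto[OF fin] by (auto simp: card_gt_0_iff)
  next
    case False
    then obtain a where a: "a \<in> carrier G" "ord a = group_exp G" by (auto simp: A_def)
    have "\<exists>T. T \<in> auto G \<and> T a = b" if "b \<in> A" for b
      using auto_transitive_on_max_order[OF fin pow_group_exp a, of b] that
      unfolding A_def by blast
    \<comment> \<open>Evaluation at a recovers b from \<open>\<tau> b\<close>, so
      \<open>\<tau>\<close> is injective on A.\<close>
    then obtain \<tau> where \<tau>: "\<tau> b \<in> auto G" "\<tau> b a = b" if "b \<in> A" for b by metis
    have inj: "inj_on \<tau> A" using \<tau> by (metis inj_onI)
    have sub: "\<tau> ` A \<subseteq> auto G" using \<tau> by auto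
    have "card A < card (auto G)" if nc: "\<not> cyclic_group G"
    proof -
      have "carrier G \<noteq> range (\<lambda>i::int. a [^]\<^bsub>G\<^esub> i)" using nc a(1) cyclic_group by blast
      then obtain T y where T: "T \<in> auto G" "T a = a" "y \<in> carrier G" "T y \<noteq> y"
        using auto_nontrivial_stabilizer[OF fin pow_group_exp a] by blast
      \<comment> \<open>The identity and T are distinct and both fix a, but the only member of the
        image of \<open>\<tau>\<close> fixing a is \<open>\<tau> a\<close>; hence
        \<open>\<tau>\<close> misses at least one of the two.\<close>
      let ?I = "\<lambda>x\<in>carrier G. x"
      have "?I \<in> auto G" by (rule id_in_auto)
      moreover have "?I \<noteq> T" using T by auto
      moreover have "S \<in> \<tau> ` A \<Longrightarrow> S a = a \<Longrightarrow> S = \<tau> a" for S using \<tau> by auto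
      ultimately have "\<tau> ` A \<noteq> auto G" using T a by (metis restrict_apply')
      then have "card (\<tau> ` A) < card (auto G)"
        using sub finite_auto[OF fin] by (intro psubset_card_mono) auto
      then show ?thesis using inj by (simp add: card_image)
    qed
    then show ?thesis using card_inj_on_le[OF inj sub finite_auto[OF fin]] by blast
  qed
  moreover have "card (auto G) \<le> card A" if "cyclic_group G"
    using that card_auto_cyclic_le[OF fin] A unfolding cyclic_group by metis
  ultimately show ?thesis unfolding A order_AutoGroup
    by (cases "cyclic_group G") (simp_all add: order_antisym)
qed

end
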